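(* Let $(\mathfrak g,[\cdot,\cdot]_{\mathfrak g},\phi_{\mathfrak g},B)$ be an involutive quadratic hom-Lie algebra over $\mathbb R$. Set $V_0=\mathfrak g$, $V_1=\mathbb R$, $d=0:V_1\to V_0$, $\phi_0=\phi_{\mathfrak g}$, $\phi_1=\mathrm{Id}_{\mathbb R}$, and define $$l_2(x,y)=[x,y]_{\mathfrak g},\qquad l_2(x,m)=l_2(m,x)=0,\qquad l_2(m,n)=0,\qquad l_3^B(x,y,z)=B([x,y]_{\mathfrak g},z)$$ for $x,y,z\in\mathfrak g$ and $m,n\in\mathbb R$. Then $(\mathbb R\xrightarrow{0}\mathfrak g,l_2,l_3^B,\phi_{\mathfrak g},\mathrm{Id})$ is a skeletal hom-Lie 2-algebra, i.e. a 2-term $HL_\infty$-algebra with $d=0$.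
   Context: **Hom-Lie algebra.** A triple $(\mathfrak g,[\cdot,\cdot]_{\mathfrak g},\phi_{\mathfrak g})$ of a vector space, a skew-symmetric bilinear bracket and a linear map $\phi_{\mathfrak g}:\mathfrak g\to\mathfrak g$ with $\phi_{\mathfrak g}[u,v]_{\mathfrak g}=[\phi_{\mathfrak g}(u),\phi_{\mathfrak g}(v)]_{\mathfrak g}$ and $[\phi_{\mathfrak g}(u),[v,w]_{\mathfrak g}]_{\mathfrak g}+[\phi_{\mathfrak g}(v),[w,u]_{\mathfrak g}]_{\mathfrak g}+[\phi_{\mathfrak g}(w),[u,v]_{\mathfrak g}]_{\mathfrak g}=0$. It is involutive if $\phi_{\mathfrak g}^2=\mathrm{Id}$. **Quadratic hom-Lie algebra.** A hom-Lie algebra with a symmetric nondegenerate bilinear form $B:\mathfrak g\times\mathfrak g\to\mathbb R$ such that $B([x,y]_{\mathfrak g},z)=-B([x,z]_{\mathfrak g},y)$ and $B(\phi_{\mathfrak g}(x),y)=B(x,\phi_{\mathfrak g}(y))$ for all $x,y,z\in\mathfrak g$. **2-term $HL_\infty$-algebras.** A 2-term $HL_\infty$-algebra $(V_1\xrightarrow{d}V_0,l_2,l_3,\phi_0,\phi_1)$ consists of a linear map $d:V_1\to V_0$; bilinear maps $l_2:V_i\times V_j\to V_{i+j}$ ($i,j\in\{0,1\}$, $V_2=0$); linear maps $\phi_0:V_0\to V_0$, $\phi_1:V_1\to V_1$ with $\phi_0\circ d=d\circ\phi_1$; and a skew-symmetric trilinear map $l_3:V_0\times V_0\times V_0\to V_1$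 with $l_3(\phi_0(x),\phi_0(y),\phi_0(z))=\phi_1(l_3(x,y,z))$, such that for all $w,x,y,z\in V_0$, $m,n\in V_1$: (a) $l_2(x,y)=-l_2(y,x)$; (b) $l_2(x,m)=-l_2(m,x)$; (c) $l_2(m,n)=0$; (d) $d\,l_2(x,m)=l_2(x,dm)$; (e) $l_2(dm,n)=l_2(m,dn)$; (f) $\phi_0(l_2(x,y))=l_2(\phi_0(x),\phi_0(y))$; (g) $\phi_1(l_2(x,m))=l_2(\phi_0(x),\phi_1(m))$; (h) $d\,l_3(x,y,z)=l_2(\phi_0(x),l_2(y,z))+l_2(\phi_0(y),l_2(z,x))+l_2(\phi_0(z),l_2(x,y))$; (i) $l_3(x,y,dm)=l_2(\phi_0(x),l_2(y,m))+l_2(\phi_0(y),l_2(m,x))+l_2(\phi_1(m),l_2(x,y))$; (j) $l_3(l_2(w,x),\phi_0(y),\phi_0(z))+l_2(l_3(w,x,z),\phi_0^2(y))+l_3(\phi_0(w),l_2(x,z),\phi_0(y))+l_3(l_2(w,z),\phi_0(x),\phi_0(y))=l_2(l_3(w,x,y),\phi_0^2(z))+l_3(l_2(w,y),\phi_0(x),\phi_0(z))+l_3(\phi_0(w),l_2(x,y),\phi_0(z))+l_2(\phi_0^2(w),l_3(x,y,z))+l_2(l_3(w,y,z),\phi_0^2(x))+l_3(\phi_0(w),l_2(y,z),\phi_0(x))$. It is *skeletal* if $d=0$. *)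

theory Defs
  imports "HOL-Analysis.Analysis"
begin

locale hom_lie_algebra =
  fixes bracket :: "'g::real_vector \<Rightarrow> 'g \<Rightarrow> 'g"
    and \<phi> :: "'g \<Rightarrow> 'g"
  assumes bilinear_bracket: "bilinear bracket"
    and bracket_skew: "bracket u v = - bracket v u"
    and linear_phi: "linear \<phi>"
    and phi_bracket: "\<phi> (bracket u v) = bracket (\<phi> u) (\<phi> v)"
    and hom_jacobi:
      "bracket (\<phi> u) (bracket v w) + bracket (\<phi> v) (bracket w u) + bracket (\<phi> w) (bracket u v) = 0"

locale involutive_hom_lie_algebra = hom_lie_algebra +
  assumes phi_involutive: "\<phi> \<circ> \<phi> = id"

locale quadratic_hom_lie_algebra = hom_lie_algebra bracket \<phi>
  for bracket :: "'g::real_vector \<Rightarrow> 'g \<Rightarrow> 'g" and \<phi> :: "'g \<Rightarrow> 'g" +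
  fixes B :: "'g \<Rightarrow> 'g \<Rightarrow> real"
  assumes bilinear_B: "bilinear B"
    and B_sym: "B x y = B y x"
    and B_nondegenerate: "(\<And>y. B x y = 0) \<Longrightarrow> x = 0"
    and B_bracket: "B (bracket x y) z = - B (bracket x z) y"
    and B_phi: "B (\<phi> x) y = B x (\<phi> y)"

definition trilinear ::
  "('a::real_vector \<Rightarrow> 'a \<Rightarrow> 'a \<Rightarrow> 'b::real_vector) \<Rightarrow> bool" where
  "trilinear f \<longleftrightarrow>
     (\<forall>y z. linear (\<lambda>x. f x y z)) \<and> (\<forall>x z. linear (\<lambda>y. f x y z)) \<and> (\<forall>x y. linear (\<lambda>z. f x y z))"

definition skew_symmetric3 ::
  "('a \<Rightarrow> 'a \<Rightarrow> 'a \<Rightarrow> 'b::real_vector) \<Rightarrow> bool" where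
  "skew_symmetric3 f \<longleftrightarrow>
     (\<forall>x y z. f y x z = - f x y z \<and> f x z y = - f x y z \<and> f z y x = - f x y z)"

text \<open>
  The graded operation \<open>l\<^sub>2 : V\<^sub>i \<times> V\<^sub>j \<rightarrow> V\<^sub>i\<^sub>+\<^sub>j\<close> is given by its four components
  \<open>l00\<close>, \<open>l01\<close>, \<open>l10\<close>, \<open>l11\<close>, the two digits being the degrees of the arguments.
  There is no type for \<open>V\<^sub>2 = 0\<close>: \<open>l11\<close> formally takes values in \<open>V\<^sub>1\<close>, and
  \<open>l11_zero\<close> confines them to the zero subspace.
\<close>

locale two_term_HL_infinity =
  fixes d :: "'v1::real_vector \<Rightarrow> 'v0::real_vector"
    and l00 :: "'v0 \<Rightarrow> 'v0 \<Rightarrow> 'v0"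
    and l01 :: "'v0 \<Rightarrow> 'v1 \<Rightarrow> 'v1"
    and l10 :: "'v1 \<Rightarrow> 'v0 \<Rightarrow> 'v1"
    and l11 :: "'v1 \<Rightarrow> 'v1 \<Rightarrow> 'v1"
    and l3 :: "'v0 \<Rightarrow> 'v0 \<Rightarrow> 'v0 \<Rightarrow> 'v1"
    and \<phi>0 :: "'v0 \<Rightarrow> 'v0"
    and \<phi>1 :: "'v1 \<Rightarrow> 'v1"
  assumes linear_d: "linear d"
    and bilinear_l00: "bilinear l00"
    and bilinear_l01: "bilinear l01"
    and bilinear_l10: "bilinear l10"
    and bilinear_l11: "bilinear l11"
    and linear_phi0: "linear \<phi>0"
    and linear_phi1: "linear \<phi>1"
    and phi_d: "\<phi>0 \<circ> d = d \<circ> \<phi>1"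
    and trilinear_l3: "trilinear l3"
    and skew_l3: "skew_symmetric3 l3"
    and phi_l3: "l3 (\<phi>0 x) (\<phi>0 y) (\<phi>0 z) = \<phi>1 (l3 x y z)"
    and l00_skew: "l00 x y = - l00 y x"
    and l01_l10: "l01 x m = - l10 m x"
    and l11_zero: "l11 m n = 0"
    and d_l01: "d (l01 x m) = l00 x (d m)"
    and l01_d: "l01 (d m) n = l10 m (d n)"
    and phi_l00: "\<phi>0 (l00 x y) = l00 (\<phi>0 x) (\<phi>0 y)"
    and phi_l01: "\<phi>1 (l01 x m) = l01 (\<phi>0 x) (\<phi>1 m)"
    and d_l3:
      "d (l3 x y z) = l00 (\<phi>0 x) (l00 y z) + l00 (\<phi>0 y) (l00 z x) + l00 (\<phi>0 z) (l00 x y)"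
    and l3_d:
      "l3 x y (d m) = l01 (\<phi>0 x) (l01 y m) + l01 (\<phi>0 y) (l10 m x) + l10 (\<phi>1 m) (l00 x y)"
    and l3_coherence:
      "l3 (l00 w x) (\<phi>0 y) (\<phi>0 z) + l10 (l3 w x z) (\<phi>0 (\<phi>0 y))
         + l3 (\<phi>0 w) (l00 x z) (\<phi>0 y) + l3 (l00 w z) (\<phi>0 x) (\<phi>0 y)
       = l10 (l3 w x y) (\<phi>0 (\<phi>0 z)) + l3 (l00 w y) (\<phi>0 x) (\<phi>0 z)
         + l3 (\<phi>0 w) (l00 x y) (\<phi>0 z) + l01 (\<phi>0 (\<phi>0 w)) (l3 x y z)
         + l10 (l3 w y z) (\<phi>0 (\<phi>0 x)) + l3 (\<phi>0 w) (l00 y z) (\<phi>0 x)"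

locale skeletal_hom_lie_2_algebra = two_term_HL_infinity +
  assumes skeletal: "d = (\<lambda>_. 0)"

end

theory Submission
  imports Defs
begin

text \<open>
  Invariance of \<open>B\<close> makes \<open>B [x, y] z\<close> totally skew-symmetric.
  All six nonzero terms of the coherence law reduce, up to sign, to
  \<open>P = B (\<phi> [w, x]) [y, z]\<close>, \<open>Q = B (\<phi> [w, y]) [x, z]\<close> and \<open>R = B (\<phi> [w, z]) [x, y]\<close>.
  The law then becomes \<open>P - Q + R = Q - R - P\<close>, and \<open>P - Q + R = 0\<close> is the
  hom-Jacobi identity paired with \<open>\<phi> w\<close>.
  Involutivity is what makes the form invariant under \<open>\<phi>\<close>.
\<close>

context quadratic_hom_lie_algebra
begin

lemma form_swap12: "B (bracket y x) z = - B (bracket x y) z"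
  using bracket_skew[of y x] by (simp add: bilinear_lneg[OF bilinear_B])

text \<open>Skewness of the bracket swaps the first two arguments and \<open>B_bracket\<close> the
  last two. The outer transposition is the product (12)(23)(12), three sign changes.\<close>

lemma form_skew_symmetric3: "skew_symmetric3 (\<lambda>x y z. B (bracket x y) z)"
  unfolding skew_symmetric3_def
proof (intro allI conjI)
  fix x y z
  show "B (bracket y x) z = - B (bracket x y) z"
    by (rule form_swap12)
  show "B (bracket x z) y = - B (bracket x y) z"
    using B_bracket[of x y z] by simp
  show "B (bracket z y) x = - B (bracket x y) z"
    using form_swap12[of z y x] B_bracket[of y z x] form_swap12[of y x z] by simp
qed

lemma form_trilinear: "trilinear (\<lambda>x y z. B (bracket x y) z)"
  unfolding trilinear_def
proof (intro allI conjI)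
  have bracket_linear: "linear (\<lambda>x. bracket x y)" "linear (bracket x)"
    and B_linear: "linear (\<lambda>x. B x z)" "linear (B u)" for x y z u
    using bilinear_bracket bilinear_B unfolding bilinear_def by auto
  fix x y z
  show "linear (\<lambda>x. B (bracket x y) z)"
    using linear_compose[OF bracket_linear(1) B_linear(1)] by (simp add: o_def)
  show "linear (\<lambda>y. B (bracket x y) z)"
    using linear_compose[OF bracket_linear(2) B_linear(1)] by (simp add: o_def)
  show "linear (\<lambda>z. B (bracket x y) z)"
    by (rule B_linear(2))
qed

text \<open>A cyclic shift brings \<open>\<phi> y\<close> and \<open>\<phi> z\<close> together in
  one bracket; there \<open>\<phi>\<close> factors out and, being self-adjoint for \<open>B\<close>,
  moves onto \<open>u\<close>.\<close>

lemma form_hom_outer: "B (bracket u (\<phi> y)) (\<phi> z) = B (\<phi> u) (bracket y z)"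
proof -
  have "B (bracket u (\<phi> y)) (\<phi> z) = B (bracket (\<phi> y) (\<phi> z)) u"
    using form_swap12[of u "\<phi> y" "\<phi> z"] B_bracket[of "\<phi> y" u "\<phi> z"] by simp
  also have "\<dots> = B (bracket y z) (\<phi> u)"
    by (simp add: phi_bracket[symmetric] B_phi)
  also have "\<dots> = B (\<phi> u) (bracket y z)"
    by (rule B_sym)
  finally show ?thesis .
qed

lemma form_hom_inner: "B (bracket (\<phi> w) u) (\<phi> z) = - B (\<phi> (bracket w z)) u"
  using B_bracket[of "\<phi> w" u "\<phi> z"] by (simp add: phi_bracket)

lemma hom_jacobi_paired:
  "B (\<phi> (bracket w x)) (bracket y z) - B (\<phi> (bracket w y)) (bracket x z)
     + B (\<phi> (bracket w z)) (bracket x y) = 0"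
proof -
  \<comment> \<open>The sign from \<open>form_hom_inner\<close> cancels against the one from
    reversing the bracket of \<open>a\<close> and \<open>w\<close>.\<close>
  have pair: "B (bracket (\<phi> a) u) (\<phi> w) = B (\<phi> (bracket w a)) u" for a u
    using form_hom_inner[of a u w] bracket_skew[of a w]
    by (simp add: linear_neg[OF linear_phi] bilinear_lneg[OF bilinear_B])
  have "B (bracket (\<phi> x) (bracket y z) + bracket (\<phi> y) (bracket z x)
      + bracket (\<phi> z) (bracket x y)) (\<phi> w) = 0"
    by (simp add: hom_jacobi bilinear_lzero[OF bilinear_B])
  then show ?thesis
    \<comment> \<open>The cyclic order in hom-Jacobi gives \<open>bracket z x\<close>; turning it
      into \<open>bracket x z\<close> produces the middle minus sign.\<close>
    using bracket_skew[of z x]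
    by (simp add: bilinear_ladd[OF bilinear_B] pair bilinear_rneg[OF bilinear_B])
qed

lemma form_coherence:
  "B (bracket (bracket w x) (\<phi> y)) (\<phi> z) + B (bracket (\<phi> w) (bracket x z)) (\<phi> y)
     + B (bracket (bracket w z) (\<phi> x)) (\<phi> y)
   = B (bracket (bracket w y) (\<phi> x)) (\<phi> z) + B (bracket (\<phi> w) (bracket x y)) (\<phi> z)
     + B (bracket (\<phi> w) (bracket y z)) (\<phi> x)"
  \<comment> \<open>The two sides become negatives of each other, and the paired Jacobi identity
    makes both vanish.\<close>
  using hom_jacobi_paired[of w x y z] by (simp add: form_hom_outer form_hom_inner)

text \<open>Pulling \<open>\<phi>\<close> out of the bracket and moving it across \<open>B\<close>
  leaves its square on \<open>z\<close>. Since \<open>\<phi>1\<close> is the identity, this is the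
  compatibility of \<open>l3\<close> with the twists.\<close>

lemma form_phi_invariant:
  assumes "\<phi> \<circ> \<phi> = id"
  shows "B (bracket (\<phi> x) (\<phi> y)) (\<phi> z) = B (bracket x y) z"
proof -
  have "B (bracket (\<phi> x) (\<phi> y)) (\<phi> z) = B (bracket x y) ((\<phi> \<circ> \<phi>) z)"
    by (simp add: phi_bracket[symmetric] B_phi)
  with assms show ?thesis by simp
qed

end

theorem mainTheorem3:
  fixes bracket :: "'g::real_vector \<Rightarrow> 'g \<Rightarrow> 'g"
    and \<phi> :: "'g \<Rightarrow> 'g"
    and B :: "'g \<Rightarrow> 'g \<Rightarrow> real"
  assumes "quadratic_hom_lie_algebra bracket \<phi> B"
    and "involutive_hom_lie_algebra bracket \<phi>"
  shows "skeletal_hom_lie_2_algebra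
           (\<lambda>_ :: real. 0 :: 'g)
           bracket
           (\<lambda>x m. 0)
           (\<lambda>m x. 0)
           (\<lambda>m n. 0)
           (\<lambda>x y z. B (bracket x y) z)
           \<phi>
           id"
proof -
  interpret quadratic_hom_lie_algebra bracket \<phi> B by fact
  interpret involutive_hom_lie_algebra bracket \<phi> by fact
  show ?thesis
  proof (intro skeletal_hom_lie_2_algebra.intro two_term_HL_infinity.intro
      skeletal_hom_lie_2_algebra_axioms.intro)
    show "\<phi> \<circ> (\<lambda>_. 0) = (\<lambda>_. 0) \<circ> (id :: real \<Rightarrow> real)"
      using linear_0[OF linear_phi] by auto
    show "trilinear (\<lambda>x y z. B (bracket x y) z)"
      by (rule form_trilinear)
    show "skew_symmetric3 (\<lambda>x y z. B (bracket x y) z)"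
      by (rule form_skew_symmetric3)
    show "bracket x y = - bracket y x" for x y
      by (rule bracket_skew)
    show "bilinear bracket" "linear \<phi>"
      by (rule bilinear_bracket linear_phi)+
    show "B (bracket (\<phi> x) (\<phi> y)) (\<phi> z) = id (B (bracket x y) z)" for x y z
      by (simp add: form_phi_invariant[OF phi_involutive])
    show "\<phi> (bracket x y) = bracket (\<phi> x) (\<phi> y)" for x y
      by (rule phi_bracket)
    show "linear (id :: real \<Rightarrow> real)"
      by (rule linear_id)
  \<comment> \<open>With \<open>d\<close> zero, the law for \<open>d (l3 x y z)\<close> is exactly
    hom-Jacobi. In the coherence law the \<open>l01\<close> and \<open>l10\<close> terms drop out,
    leaving \<open>form_coherence\<close>.\<close>
  qed (simp_all add: bilinear_def linear_zero bilinear_rzero[OF bilinear_bracket]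
      bilinear_rzero[OF bilinear_B] hom_jacobi form_coherence)
qed

end
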